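(* Let $n \geq 1$, let $\mathbb{S}^{2n+1}$ be the unit sphere in $\mathbb{C}^{n+1}$, and let $\mathrm{U}(1)$ denote the center of the unitary group $\mathrm{U}(n+1)$, acting on $\mathbb{S}^{2n+1}$ by restriction of the natural action of $\mathrm{U}(n+1)$. Then all orbits of $\mathrm{U}(1)$ in $\mathbb{S}^{2n+1}$ are isometrically congruent to each other.
   Context: $\mathbb{S}^{2n+1}$ carries its standard round Riemannian metric. Two subsets $A, B$ of a Riemannian manifold $M$ are isometrically congruent if there is an isometry $g$ of $M$ with $g(A) = B$. The orbits of this $\mathrm{U}(1)$-action are the fibers of the Hopf fibration $\mathbb{S}^{2n+1} \to \mathbb{C}\mathrm{P}^n$. *)

theory Defs
  imports "HOL-Analysis.Analysis" "HOL-Algebra.Group_Action"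
begin

section \<open>Smooth functions on open subsets of a normed space\<close>

text \<open>
  \<open>Ck_on k U f\<close> is meant for open \<open>U\<close>: all iterated directional derivatives of \<open>f\<close> of order
  at most \<open>k\<close> exist and are continuous on \<open>U\<close>, as functions of the base point.
\<close>

fun Ck_on :: "nat \<Rightarrow> 'a::real_normed_vector set \<Rightarrow> ('a \<Rightarrow> 'b::real_normed_vector) \<Rightarrow> bool"
  where
    "Ck_on 0 U f \<longleftrightarrow> continuous_on U f"
  | "Ck_on (Suc k) U f \<longleftrightarrow>
       (\<forall>x\<in>U. f differentiable (at x)) \<and> (\<forall>v. Ck_on k U (\<lambda>x. frechet_derivative f (at x) v))"

definition smooth_on :: "'a::real_normed_vector set \<Rightarrow> ('a \<Rightarrow> 'b::real_normed_vector) \<Rightarrow> bool"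
  where "smooth_on U f \<longleftrightarrow> (\<forall>k. Ck_on k U f)"


section \<open>Riemannian isometries of embedded submanifolds\<close>

text \<open>
  In this section \<open>M\<close> is an embedded submanifold of a real inner product space, with the
  Riemannian metric induced by the ambient inner product; for a unit sphere this is the round
  metric. Tangent vectors are velocities of smooth curves in \<open>M\<close>.
\<close>

definition tangent_space :: "'a::real_inner set \<Rightarrow> 'a \<Rightarrow> 'a set"
  where "tangent_space M p =
    {v. \<exists>\<gamma> e. e > 0 \<and> smooth_on {-e<..<e} \<gamma> \<and> \<gamma> ` {-e<..<e} \<subseteq> M \<and> \<gamma> 0 = p \<and>
          (\<gamma> has_vector_derivative v) (at (0::real))}"

definition local_smooth_extension ::
    "'a::real_inner set \<Rightarrow> ('a \<Rightarrow> 'a) \<Rightarrow> 'a \<Rightarrow> ('a \<Rightarrow> 'a) \<Rightarrow> bool"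
  where "local_smooth_extension M f p F \<longleftrightarrow>
    (\<exists>U. open U \<and> p \<in> U \<and> smooth_on U F \<and> (\<forall>x\<in>U \<inter> M. F x = f x))"

definition smooth_map :: "'a::real_inner set \<Rightarrow> ('a \<Rightarrow> 'a) \<Rightarrow> bool"
  where "smooth_map M f \<longleftrightarrow> (\<forall>p\<in>M. \<exists>F. local_smooth_extension M f p F)"

text \<open>
  A Riemannian isometry is a diffeomorphism whose differential at each point preserves the metric.
  The differential of \<open>g\<close> at \<open>p\<close> is the restriction to the tangent space of the derivative of any
  local smooth extension \<open>F\<close>; by the chain rule it does not depend on the choice of \<open>F\<close>.
\<close>

definition riemannian_isometry :: "'a::real_inner set \<Rightarrow> ('a \<Rightarrow> 'a) \<Rightarrow> bool"
  where "riemannian_isometry M g \<longleftrightarrow>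
    bij_betw g M M \<and> smooth_map M g \<and> smooth_map M (inv_into M g) \<and>
    (\<forall>p\<in>M. \<exists>F. local_smooth_extension M g p F \<and>
       (\<forall>u\<in>tangent_space M p. \<forall>v\<in>tangent_space M p.
          frechet_derivative F (at p) u \<bullet> frechet_derivative F (at p) v = u \<bullet> v))"

definition isometrically_congruent :: "'a::real_inner set \<Rightarrow> 'a set \<Rightarrow> 'a set \<Rightarrow> bool"
  where "isometrically_congruent M A B \<longleftrightarrow>
    A \<subseteq> M \<and> B \<subseteq> M \<and> (\<exists>g. riemannian_isometry M g \<and> g ` A = B)"


section \<open>The unitary group, its center and their action on the unit sphere\<close>

definition conjugate_transpose :: "complex^'m^'m \<Rightarrow> complex^'m^'m"
  where "conjugate_transpose A = (\<chi> i j. cnj (A $ j $ i))"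

definition unitary_group :: "(complex^'m^'m) monoid"
  where "unitary_group =
    \<lparr> carrier = {A. conjugate_transpose A ** A = mat 1 \<and> A ** conjugate_transpose A = mat 1},
      monoid.mult = (**), one = mat 1 \<rparr>"

definition center :: "('g, 'x) monoid_scheme \<Rightarrow> 'g set"
  where "center G = {z \<in> carrier G. \<forall>g\<in>carrier G. z \<otimes>\<^bsub>G\<^esub> g = g \<otimes>\<^bsub>G\<^esub> z}"

text \<open>The center of the unitary group, as a group in its own right.\<close>

definition U1 :: "(complex^'m^'m) monoid"
  where "U1 = unitary_group\<lparr>carrier := center unitary_group\<rparr>"

text \<open>The restriction to the sphere is extensional, as \<open>group_action\<close> requires.\<close>

definition sphere_action :: "complex^'m^'m \<Rightarrow> complex^'m \<Rightarrow> complex^'m"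
  where "sphere_action A = (\<lambda>x\<in>sphere 0 1. A *v x)"


section \<open>Consistency of the definitions\<close>

lemma cos_sin_has_derivative:
  fixes a b :: "'a::real_inner"
  shows "((\<lambda>t. cos (r * t) *\<^sub>R a + sin (r * t) *\<^sub>R b) has_derivative
      (\<lambda>v. cos (r * x) *\<^sub>R ((v * r) *\<^sub>R b) + sin (r * x) *\<^sub>R ((- v * r) *\<^sub>R a))) (at x)"
  by (auto intro!: derivative_eq_intros simp: algebra_simps fun_eq_iff)

lemma smooth_on_cos_sin:
  fixes a b :: "'a::real_inner"
  shows "smooth_on U (\<lambda>t. cos (r * t) *\<^sub>R a + sin (r * t) *\<^sub>R b)"
proof -
  have "Ck_on k U (\<lambda>t. cos (r * t) *\<^sub>R a + sin (r * t) *\<^sub>R b)" for k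
  proof (induction k arbitrary: a b)
    case 0
    show ?case by (auto intro!: continuous_intros)
  next
    case (Suc k)
    have F: "frechet_derivative (\<lambda>t. cos (r * t) *\<^sub>R a + sin (r * t) *\<^sub>R b) (at x)
        = (\<lambda>v. cos (r * x) *\<^sub>R ((v * r) *\<^sub>R b) + sin (r * x) *\<^sub>R ((- v * r) *\<^sub>R a))" for x
      by (rule frechet_derivative_at[OF cos_sin_has_derivative, symmetric])
    show ?case
      unfolding Ck_on.simps F using Suc cos_sin_has_derivative differentiableI by blast
  qed
  then show ?thesis by (simp add: smooth_on_def)
qed

lemma tangent_space_sphere:
  fixes p :: "'a::real_inner"
  assumes p: "p \<in> sphere 0 1"
  shows "tangent_space (sphere 0 1) p = {v. p \<bullet> v = 0}"
proof (intro equalityI subsetI)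
  fix v assume "v \<in> tangent_space (sphere 0 1) p"
  then obtain \<gamma> and e :: real where e: "e > 0" and im: "\<gamma> ` {-e<..<e} \<subseteq> sphere 0 1"
    and 0: "\<gamma> 0 = p" and d: "(\<gamma> has_vector_derivative v) (at 0)"
    by (auto simp: tangent_space_def)
  have "((\<lambda>t. \<gamma> t \<bullet> \<gamma> t) has_derivative (\<lambda>t. \<gamma> 0 \<bullet> (t *\<^sub>R v) + (t *\<^sub>R v) \<bullet> \<gamma> 0)) (at 0)"
    using d unfolding has_vector_derivative_def by (intro has_derivative_inner)
  moreover have "((\<lambda>t. \<gamma> t \<bullet> \<gamma> t) has_derivative (\<lambda>t. 0)) (at 0)"
  proof (rule has_derivative_transform_within_open[where s = "{-e<..<e}"])
    show "((\<lambda>t. 1) has_derivative (\<lambda>t. 0)) (at (0::real))" by simp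
    show "1 = \<gamma> t \<bullet> \<gamma> t" if "t \<in> {-e<..<e}" for t
      using im that by (fastforce simp: dot_square_norm)
  qed (use e in auto)
  ultimately have "(\<lambda>t. \<gamma> 0 \<bullet> (t *\<^sub>R v) + (t *\<^sub>R v) \<bullet> \<gamma> 0) = (\<lambda>t. 0)"
    by (rule has_derivative_unique)
  from fun_cong[OF this, of 1] show "v \<in> {v. p \<bullet> v = 0}"
    by (simp add: 0 inner_commute)
next
  fix v assume "v \<in> {v. p \<bullet> v = 0}"
  then have pv: "p \<bullet> v = 0" by simp
  have pp: "p \<bullet> p = 1" using p by (simp add: dot_square_norm)
  define r where "r = norm v"
  define w where "w = v /\<^sub>R r"
  define \<gamma> where "\<gamma> t = cos (r * t) *\<^sub>R p + sin (r * t) *\<^sub>R w" for t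
  have rw: "r *\<^sub>R w = v" by (cases "v = 0") (simp_all add: w_def r_def)
  have ww: "v = 0 \<or> w \<bullet> w = 1"
    by (cases "v = 0") (simp_all add: w_def r_def dot_square_norm)
  have pw: "p \<bullet> w = 0" "w \<bullet> p = 0" using pv by (simp_all add: w_def inner_commute)
  have "\<gamma> t \<bullet> \<gamma> t = 1" for t
  proof (cases "v = 0")
    case True
    then show ?thesis by (simp add: \<gamma>_def r_def pp)
  next
    case False
    with ww have "\<gamma> t \<bullet> \<gamma> t = (cos (r * t))\<^sup>2 + (sin (r * t))\<^sup>2"
      by (simp add: \<gamma>_def inner_add_left inner_add_right pp pw power2_eq_square)
    then show ?thesis by simp
  qed
  then have "\<gamma> ` {-1<..<1} \<subseteq> sphere 0 1"
    by (auto simp: norm_eq_1)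
  moreover have "(\<gamma> has_derivative (\<lambda>t. t *\<^sub>R (r *\<^sub>R w))) (at 0)"
    using cos_sin_has_derivative[of r p w 0] by (simp add: \<gamma>_def[abs_def])
  then have "(\<gamma> has_vector_derivative v) (at 0)"
    by (simp only: has_vector_derivative_def rw)
  moreover have "smooth_on {-1<..<1} \<gamma>"
    unfolding \<gamma>_def[abs_def] by (rule smooth_on_cos_sin)
  moreover have "\<gamma> 0 = p" by (simp add: \<gamma>_def)
  ultimately show "v \<in> tangent_space (sphere 0 1) p"
    unfolding tangent_space_def by (intro CollectI exI[of _ \<gamma>] exI[of _ "1::real"]) simp
qed

lemma conjugate_transpose_mult:
  "conjugate_transpose (A ** B) = conjugate_transpose B ** conjugate_transpose A"
  by (simp add: conjugate_transpose_def matrix_matrix_mult_def vec_eq_iff mult.commute)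

lemma conjugate_transpose_conjugate_transpose:
  "conjugate_transpose (conjugate_transpose A) = A"
  by (simp add: conjugate_transpose_def vec_eq_iff)

lemma conjugate_transpose_mat_1: "conjugate_transpose (mat 1) = mat 1"
  by (simp add: conjugate_transpose_def mat_def vec_eq_iff)

lemma group_unitary_group: "group (unitary_group :: (complex^'m^'m) monoid)"
proof (rule groupI)
  fix x y z :: "complex^'m^'m"
  assume x: "x \<in> carrier unitary_group" and y: "y \<in> carrier unitary_group"
  let ?h = "conjugate_transpose :: complex^'m^'m \<Rightarrow> _"
  have "?h (x ** y) ** (x ** y) = ?h y ** (?h x ** x) ** y"
    "(x ** y) ** ?h (x ** y) = x ** (y ** ?h y) ** ?h x"
    by (simp_all only: conjugate_transpose_mult matrix_mul_assoc)
  then show "x \<otimes>\<^bsub>unitary_group\<^esub> y \<in> carrier unitary_group"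
    using x y by (simp add: unitary_group_def)
next
  fix x :: "complex^'m^'m"
  assume "x \<in> carrier unitary_group"
  then show "\<exists>y\<in>carrier unitary_group. y \<otimes>\<^bsub>unitary_group\<^esub> x = \<one>\<^bsub>unitary_group\<^esub>"
    by (intro bexI[of _ "conjugate_transpose x"])
      (auto simp: unitary_group_def conjugate_transpose_conjugate_transpose)
qed (auto simp: unitary_group_def conjugate_transpose_mat_1 matrix_mul_assoc)

lemma subgroup_center:
  fixes G (structure)
  assumes "group G"
  shows "subgroup (center G) G"
proof -
  interpret group G by fact
  show ?thesis
  proof (rule subgroupI)
    fix a assume a: "a \<in> center G"
    have "inv a \<otimes> g = g \<otimes> inv a" if g: "g \<in> carrier G" for g
    proof -
      from a g have [simp]: "a \<in> carrier G" "g \<in> carrier G" and c: "a \<otimes> g = g \<otimes> a"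
        unfolding center_def by blast+
      have "inv a \<otimes> g = inv a \<otimes> (g \<otimes> a) \<otimes> inv a" by (simp add: m_assoc)
      also have "\<dots> = inv a \<otimes> (a \<otimes> g) \<otimes> inv a" by (simp only: c)
      also have "\<dots> = g \<otimes> inv a" by (simp flip: m_assoc)
      finally show ?thesis .
    qed
    moreover have "a \<in> carrier G" using a by (simp add: center_def)
    ultimately show "inv a \<in> center G" by (simp add: center_def)
  next
    fix a b assume a: "a \<in> center G" and b: "b \<in> center G"
    have [simp]: "a \<in> carrier G" "b \<in> carrier G" using a b by (auto simp: center_def)
    have ca: "a \<otimes> g = g \<otimes> a" and cb: "b \<otimes> g = g \<otimes> b" if "g \<in> carrier G" for g
      using a b that unfolding center_def by blast+
    have "a \<otimes> b \<otimes> g = g \<otimes> (a \<otimes> b)" if g: "g \<in> carrier G" for g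
    proof -
      have "a \<otimes> b \<otimes> g = a \<otimes> (b \<otimes> g)" using g by (simp add: m_assoc)
      also have "\<dots> = a \<otimes> (g \<otimes> b)" by (simp only: cb[OF g])
      also have "\<dots> = (a \<otimes> g) \<otimes> b" using g by (simp add: m_assoc)
      also have "\<dots> = (g \<otimes> a) \<otimes> b" by (simp only: ca[OF g])
      finally show ?thesis using g by (simp add: m_assoc)
    qed
    then show "a \<otimes> b \<in> center G" by (simp add: center_def)
  next
    show "center G \<subseteq> carrier G" by (auto simp: center_def)
    have "\<one> \<in> center G" by (simp add: center_def)
    then show "center G \<noteq> {}" by blast
  qed
qed

lemma group_U1: "group (U1 :: (complex^'m^'m) monoid)"
  unfolding U1_def
  by (rule subgroup.subgroup_is_group[OF subgroup_center[OF group_unitary_group] group_unitary_group])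

lemma inner_eq_Re: "(x::complex^'m) \<bullet> y = Re (\<Sum>i\<in>UNIV. cnj (x $ i) * y $ i)"
  by (simp add: inner_vec_def inner_complex_def)

lemma norm_unitary:
  assumes "(A :: complex^'m^'m) \<in> carrier unitary_group"
  shows "norm (A *v x) = norm x"
proof -
  have adj: "(A *v x) \<bullet> y = x \<bullet> (conjugate_transpose A *v y)" for y
  proof -
    have "(\<Sum>i\<in>UNIV. cnj ((A *v x) $ i) * y $ i)
        = (\<Sum>i\<in>UNIV. \<Sum>j\<in>UNIV. cnj (A $ i $ j) * cnj (x $ j) * y $ i)"
      by (simp add: matrix_vector_mult_def sum_distrib_right)
    also have "\<dots> = (\<Sum>j\<in>UNIV. \<Sum>i\<in>UNIV. cnj (A $ i $ j) * cnj (x $ j) * y $ i)"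
      by (rule sum.swap)
    also have "\<dots> = (\<Sum>j\<in>UNIV. cnj (x $ j) * (conjugate_transpose A *v y) $ j)"
      by (simp add: matrix_vector_mult_def conjugate_transpose_def sum_distrib_left mult_ac)
    finally show ?thesis by (simp add: inner_eq_Re)
  qed
  have "(A *v x) \<bullet> (A *v x) = x \<bullet> ((conjugate_transpose A ** A) *v x)"
    by (simp add: adj matrix_vector_mul_assoc)
  also have "\<dots> = x \<bullet> x" using assms by (simp add: unitary_group_def)
  finally show ?thesis by (simp only: norm_eq)
qed

lemma group_action_unitary_group:
  "group_action (unitary_group :: (complex^'m^'m) monoid) (sphere 0 1) sphere_action"
proof -
  interpret group "unitary_group :: (complex^'m^'m) monoid" by (rule group_unitary_group)
  have S: "A *v x \<in> sphere 0 1"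
    if "A \<in> carrier unitary_group" "x \<in> sphere 0 1" for A :: "complex^'m^'m" and x
    using that by (simp add: norm_unitary)
  have bij: "bij_betw (\<lambda>x. A *v x) (sphere 0 1) (sphere 0 1)"
    if A: "A \<in> carrier unitary_group" for A :: "complex^'m^'m"
  proof (rule bij_betw_byWitness[where f' = "\<lambda>x. conjugate_transpose A *v x"])
    have h: "conjugate_transpose A \<in> carrier unitary_group"
      using A by (simp add: unitary_group_def conjugate_transpose_conjugate_transpose)
    show "(\<lambda>x. A *v x) ` sphere 0 1 \<subseteq> sphere 0 1"
      "(\<lambda>x. conjugate_transpose A *v x) ` sphere 0 1 \<subseteq> sphere 0 1"
      using S[OF A] S[OF h] by auto
  qed (use A in \<open>auto simp: unitary_group_def matrix_vector_mul_assoc\<close>)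
  have Bij: "sphere_action A \<in> Bij (sphere 0 1)"
    if A: "A \<in> carrier unitary_group" for A :: "complex^'m^'m"
  proof -
    have "bij_betw (sphere_action A) (sphere 0 1) (sphere 0 1)"
      using bij[OF A] by (subst bij_betw_cong[where g = "\<lambda>x. A *v x"]) (simp_all add: sphere_action_def)
    then show ?thesis by (simp add: Bij_def sphere_action_def)
  qed
  have "sphere_action \<in> hom (unitary_group :: (complex^'m^'m) monoid) (BijGroup (sphere 0 1))"
  proof (rule homI)
    fix A :: "complex^'m^'m"
    assume "A \<in> carrier unitary_group"
    then show "sphere_action A \<in> carrier (BijGroup (sphere 0 1))"
      using Bij by (simp add: BijGroup_def)
  next
    fix A B :: "complex^'m^'m"
    assume A: "A \<in> carrier unitary_group" and B: "B \<in> carrier unitary_group"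
    have "sphere_action (A ** B) x = compose (sphere 0 1) (sphere_action A) (sphere_action B) x" for x
    proof (cases "x \<in> sphere 0 1")
      case True
      then show ?thesis
        using S[OF B True] by (simp add: sphere_action_def compose_def matrix_vector_mul_assoc)
    next
      case False
      then show ?thesis by (simp add: sphere_action_def compose_def)
    qed
    then have "sphere_action (A ** B) = compose (sphere 0 1) (sphere_action A) (sphere_action B)"
      by (rule ext)
    moreover have "A \<otimes>\<^bsub>unitary_group\<^esub> B = A ** B" by (simp add: unitary_group_def)
    ultimately show "sphere_action (A \<otimes>\<^bsub>unitary_group\<^esub> B)
        = sphere_action A \<otimes>\<^bsub>BijGroup (sphere 0 1)\<^esub> sphere_action B"
      using Bij[OF A] Bij[OF B] by (simp add: BijGroup_def)
  qed
  with group_BijGroup group_unitary_group show ?thesis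
    unfolding group_action_def group_hom_def group_hom_axioms_def by blast
qed

lemma group_action_U1:
  "group_action (U1 :: (complex^'m^'m) monoid) (sphere 0 1) sphere_action"
proof -
  interpret group_action "unitary_group :: (complex^'m^'m) monoid" "sphere 0 1" sphere_action
    by (rule group_action_unitary_group)
  have "sphere_action \<in> hom (U1 :: (complex^'m^'m) monoid) (BijGroup (sphere 0 1))"
  proof (rule homI)
    fix A :: "complex^'m^'m"
    assume "A \<in> carrier U1"
    then have "A \<in> carrier unitary_group" by (simp add: U1_def center_def)
    then show "sphere_action A \<in> carrier (BijGroup (sphere 0 1))"
      by (rule group_hom.hom_closed[OF group_hom])
  next
    fix A B :: "complex^'m^'m"
    assume "A \<in> carrier U1" "B \<in> carrier U1"
    then have "A \<in> carrier unitary_group" "B \<in> carrier unitary_group"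
      by (simp_all add: U1_def center_def)
    then have "sphere_action (A \<otimes>\<^bsub>unitary_group\<^esub> B)
        = sphere_action A \<otimes>\<^bsub>BijGroup (sphere 0 1)\<^esub> sphere_action B"
      by (rule group_hom.hom_mult[OF group_hom])
    then show "sphere_action (A \<otimes>\<^bsub>U1\<^esub> B)
        = sphere_action A \<otimes>\<^bsub>BijGroup (sphere 0 1)\<^esub> sphere_action B"
      by (simp add: U1_def)
  qed
  with group_BijGroup group_U1 show ?thesis
    unfolding group_action_def group_hom_def group_hom_axioms_def by blast
qed

end

theory Submission
  imports Defs
begin

text \<open>
  The unitary group acts transitively on the unit sphere, by isometries, and a unitary matrix
  commutes with the center; so a unitary matrix taking \<open>p\<close> to \<open>q\<close> takes the \<open>U1\<close>-orbit of \<open>p\<close>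
  to that of \<open>q\<close>. A matrix taking \<open>p\<close> to \<open>q\<close> is the complex reflection
  \<open>x \<mapsto> x - c \<langle>u, x\<rangle> u\<close> with \<open>u = p - q\<close> and \<open>c = 1 / \<langle>u, p\<rangle>\<close>; it is unitary because
  \<open>2 Re \<langle>u, p\<rangle> = \<langle>u, u\<rangle>\<close>.
\<close>

lemma Ck_on_const: "Ck_on k U (\<lambda>_. c)"
  by (induction k arbitrary: c) auto

text \<open>The derivative of \<open>f\<close> at every point is \<open>f\<close> itself, so each
  directional derivative is constant in the base point and a case split on the order
  suffices.\<close>

lemma smooth_on_bounded_linear:
  assumes "bounded_linear f"
  shows "smooth_on U f"
proof -
  have D: "frechet_derivative f (at x) = f" for x
    using assms by (metis bounded_linear_imp_has_derivative frechet_derivative_at)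
  have "Ck_on k U f" for k
    using assms
    by (cases k) (auto simp: D Ck_on_const bounded_linear_imp_differentiable
        linear_continuous_on)
  then show ?thesis by (simp add: smooth_on_def)
qed

lemma local_smooth_extension_bounded_linear:
  assumes "bounded_linear f" and "\<And>x. x \<in> M \<Longrightarrow> f x = g x"
  shows "local_smooth_extension M g p f"
  unfolding local_smooth_extension_def
  using assms smooth_on_bounded_linear by (intro exI[of _ UNIV]) auto

lemma bounded_linear_complex_matrix_vector_mult:
  "bounded_linear (\<lambda>x. (A :: complex^'m^'n) *v x)"
  by (intro linear_conv_bounded_linear[THEN iffD1] linearI)
    (simp_all add: matrix_vector_mult_def vec_eq_iff algebra_simps sum.distrib scaleR_sum_right)

text \<open>Polarization of \<open>norm_unitary\<close>.\<close>

lemma unitary_inner: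
  assumes "(A :: complex^'m^'m) \<in> carrier unitary_group"
  shows "(A *v x) \<bullet> (A *v y) = x \<bullet> y"
  by (simp add: dot_norm norm_unitary[OF assms] flip: matrix_vector_right_distrib)

text \<open>Both the map and its inverse extend to linear maps of the ambient space, and a linear
  map is its own derivative, so the metric condition reduces to
  \<open>unitary_inner\<close>.\<close>

lemma riemannian_isometry_unitary:
  assumes A: "(A :: complex^'m^'m) \<in> carrier unitary_group"
  shows "riemannian_isometry (sphere 0 1) ((*v) A)"
proof -
  let ?S = "sphere 0 1 :: (complex^'m) set"
  let ?B = "conjugate_transpose A"
  have B: "?B \<in> carrier unitary_group"
    using A by (simp add: unitary_group_def conjugate_transpose_conjugate_transpose)
  have BA: "?B *v (A *v x) = x" and AB: "A *v (?B *v x) = x" for x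
    using A by (simp_all add: unitary_group_def matrix_vector_mul_assoc)
  have bij: "bij_betw ((*v) A) ?S ?S"
    by (rule bij_betw_byWitness[where f' = "(*v) ?B"])
      (auto simp: BA AB norm_unitary[OF A] norm_unitary[OF B])
  \<comment> \<open>\<open>inv_into\<close> is taken on the sphere, so the linear map given by
    \<open>?B\<close> serves as its smooth extension.\<close>
  have inv: "?B *v x = inv_into ?S ((*v) A) x" if "x \<in> ?S" for x
    using that bij by (intro inv_into_f_eq[symmetric])
      (auto simp: bij_betw_def AB norm_unitary[OF B])
  have ext: "local_smooth_extension ?S ((*v) A) p ((*v) A)" for p
    by (rule local_smooth_extension_bounded_linear[OF bounded_linear_complex_matrix_vector_mult])
      simp
  have D: "frechet_derivative ((*v) A) (at p) = (*v) A" for p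
    by (metis bounded_linear_complex_matrix_vector_mult bounded_linear_imp_has_derivative
        frechet_derivative_at)
  show ?thesis
    unfolding riemannian_isometry_def smooth_map_def
    using bij ext inv
      local_smooth_extension_bounded_linear[OF bounded_linear_complex_matrix_vector_mult[of ?B]]
    by (metis D unitary_inner[OF A])
qed

lemma unitary_transitive_on_sphere:
  fixes p q :: "complex^'m"
  assumes p: "p \<in> sphere 0 1" and q: "q \<in> sphere 0 1"
  shows "\<exists>A \<in> carrier unitary_group. A *v p = q"
proof -
  \<comment> \<open>The Hermitian form, conjugate-linear in the first argument; its real part is the
    ambient inner product.\<close>
  define h :: "complex^'m \<Rightarrow> complex^'m \<Rightarrow> complex"
    where "h x y = (\<Sum>i\<in>UNIV. cnj (x $ i) * y $ i)" for x y
  have inner_h: "x \<bullet> y = Re (h x y)" for x y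
    by (simp only: inner_eq_Re h_def)
  have h_diff: "h (x - y) z = h x z - h y z" "h z (x - y) = h z x - h z y" for x y z
    by (simp_all add: h_def algebra_simps sum_subtractf)
  have h_cnj: "cnj (h x y) = h y x" for x y
    by (simp add: h_def mult.commute)
  have h_unit: "h x x = 1" if "x \<in> sphere 0 1" for x
  proof (rule complex_eqI)
    show "Re (h x x) = Re 1"
      using that by (simp add: dot_square_norm flip: inner_h)
    show "Im (h x x) = Im 1"
      using arg_cong[OF h_cnj[of x x], of Im] by simp
  qed
  define u where "u = p - q"
  \<comment> \<open>If \<open>h u p = 0\<close>, division by zero gives \<open>c = 0\<close>; then
    \<open>u = 0\<close> by \<open>u0\<close> below, so \<open>p = q\<close> and the reflection is
    the identity.\<close>
  define c where "c = 1 / h u p"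
  have huu: "h u u = h u p + cnj (h u p)"
    by (simp add: u_def h_diff h_cnj h_unit[OF p] h_unit[OF q])
  have u0: "u = 0" if "h u p = 0"
  proof -
    have "u \<bullet> u = 0"
      by (simp only: inner_h huu that) simp
    then show ?thesis by simp
  qed
  \<comment> \<open>This is the condition for the reflection with coefficient \<open>c\<close> to be
    unitary.\<close>
  have c: "cnj c * c * h u u = c + cnj c"
    by (cases "h u p = 0") (auto simp: c_def huu field_simps)
  \<comment> \<open>The matrix of the identity minus \<open>d\<close> times the rank-one matrix u
    u*; taking the adjoint conjugates \<open>d\<close>.\<close>
  define R :: "complex \<Rightarrow> complex^'m^'m"
    where "R d = (\<chi> i j. (if i = j then 1 else 0) - d * u $ i * cnj (u $ j))" for d
  have Rv: "R d *v x = (\<chi> i. x $ i - d * h u x * u $ i)" for d x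
  proof -
    have "(\<Sum>j\<in>UNIV. ((if i = j then 1 else 0) - d * u $ i * cnj (u $ j)) * x $ j)
        = x $ i - (\<Sum>j\<in>UNIV. d * u $ i * cnj (u $ j) * x $ j)" for i
      by (simp add: left_diff_distrib sum_subtractf if_distrib[of "\<lambda>a. a * _"] cong: if_cong)
    then show ?thesis
      by (simp add: R_def h_def matrix_vector_mult_def vec_eq_iff
          sum_distrib_left sum_distrib_right mult_ac)
  qed
  define A where "A = R c"
  have hA: "conjugate_transpose A = R (cnj c)"
    by (simp add: A_def R_def conjugate_transpose_def vec_eq_iff mult_ac)
  have huA: "h u (\<chi> i. x $ i - d * u $ i) = h u x - d * h u u" for x d
    by (simp add: h_def right_diff_distrib sum_subtractf sum_distrib_left mult_ac)
  have "(conjugate_transpose A ** A) *v x = x" for x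
  proof -
    \<comment> \<open>The left side is the coefficient of \<open>u\<close> subtracted from
      \<open>x\<close> when \<open>R c\<close> and then \<open>R (cnj c)\<close> are
      applied.\<close>
    have "c * h u x + cnj c * (h u x - c * h u x * h u u) = (c + cnj c - cnj c * c * h u u) * h u x"
      by (simp add: algebra_simps)
    then have "c * h u x + cnj c * (h u x - c * h u x * h u u) = 0"
      by (simp add: c)
    then have "c * h u x * u $ i + cnj c * (h u x - c * h u x * h u u) * u $ i = 0" for i
      by (metis distrib_right mult_zero_left)
    then show ?thesis
      by (simp only: matrix_vector_mul_assoc[symmetric] Rv[of c, folded A_def] hA Rv huA)
        (simp add: vec_eq_iff algebra_simps)
  qed
  then have "conjugate_transpose A ** A = mat 1"
    by (simp add: matrix_eq)
  \<comment> \<open>For square matrices a left inverse is also a right inverse.\<close>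
  then have "A \<in> carrier unitary_group"
    by (simp add: unitary_group_def matrix_left_right_inverse)
  moreover have "A *v p = q"
  proof (cases "h u p = 0")
    case True
    with u0 show ?thesis by (simp add: A_def Rv vec_eq_iff u_def)
  next
    case False
    \<comment> \<open>Hence \<open>A *v p\<close> is \<open>p - u\<close>, which is
      \<open>q\<close>.\<close>
    then have "c * h u p = 1" by (simp add: c_def)
    then show ?thesis by (simp add: A_def Rv vec_eq_iff u_def)
  qed
  ultimately show ?thesis by blast
qed

theorem proposition3p1:
  fixes n :: nat
  assumes "n \<ge> 1"
    and "CARD('m::finite) = n + 1"
  shows "\<forall>A \<in> orbits (U1 :: (complex^'m^'m) monoid) (sphere 0 1) sphere_action.
         \<forall>B \<in> orbits (U1 :: (complex^'m^'m) monoid) (sphere 0 1) sphere_action.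
           isometrically_congruent (sphere 0 1) A B"
proof (intro ballI)
  let ?S = "sphere 0 1 :: (complex^'m) set"
  let ?Z = "center unitary_group :: (complex^'m^'m) set"
  have orbit: "orbit U1 sphere_action p = (\<lambda>z. z *v p) ` ?Z" if "p \<in> ?S" for p
    using that by (auto simp: orbit_def U1_def sphere_action_def)
  have sub: "(\<lambda>z. z *v p) ` ?Z \<subseteq> ?S" if "p \<in> ?S" for p
    using that by (auto simp: center_def norm_unitary)
  fix A B
  assume "A \<in> orbits (U1 :: (complex^'m^'m) monoid) ?S sphere_action"
    and "B \<in> orbits (U1 :: (complex^'m^'m) monoid) ?S sphere_action"
  then obtain p q where p: "p \<in> ?S" and A: "A = (\<lambda>z. z *v p) ` ?Z"
    and q: "q \<in> ?S" and B: "B = (\<lambda>z. z *v q) ` ?Z"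
    unfolding orbits_def using orbit by blast
  obtain T where T: "T \<in> carrier unitary_group" and Tp: "T *v p = q"
    using unitary_transitive_on_sphere[OF p q] by blast
  have "T *v (z *v p) = z *v q" if "z \<in> ?Z" for z
  proof -
    have "z ** T = T ** z"
      using that T by (simp add: center_def unitary_group_def)
    then show ?thesis
      by (metis Tp matrix_vector_mul_assoc)
  qed
  \<comment> \<open>Both orbits are parametrized by the same center, and \<open>T\<close> matches
    them point by point.\<close>
  then have "(*v) T ` A = B"
    by (simp add: A B image_image)
  then show "isometrically_congruent ?S A B"
    unfolding isometrically_congruent_def
    using riemannian_isometry_unitary[OF T] sub[OF p] sub[OF q] A B by blast
qed

end
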